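(* For all integers $i,j\geq 0$ the following identities of formal Laurent series hold: $$W_{i,j}(z)=\psi_{i,j}(z)=\zeta_{i,j}(z).$$
   Context: Fix integers $p,q\geq 1$ and, for each $-p\leq k\leq q$, a bi-infinite sequence $(a^{(k)}_{n})_{n\in\mathbb{Z}}$ of complex numbers. Paths. A step is an ordered pair $(n,m)\rightarrow(n+1,m')$ with $n\in\mathbb{Z}_{\geq 0}$, $m,m'\in\mathbb{Z}$ and $-p\leq m'-m\leq q$. Its weight is $a_m^{(i)}$ if $m'=m+i$ with $0\leq i\leq q$, and $a_{m-j}^{(-j)}$ if $m'=m-j$ with $1\leq j\leq p$. A lattice path of length $k$ is a sequence of $k$ steps in which the final vertex of each step is the initial vertex of the next; a path of length zero is a single vertex. The weight $w(\gamma)$ of a path is the product of the weights of its steps ($1$ for length zero). For $n\geq 0$, $i,j\in\mathbb{Z}$, $\mathcal{P}_{[n,i,j]}$ is the collection of all lattice paths of length $n$ from $(0,i)$ to $(n,j)$, $W_{[n,i,j]}=\sum_{\gamma\in\mathcal{P}_{[n,i,j]}}w(\gamma)$ (empty sums are zero), and $W_{i,j}(z)=\sum_{n\geq 0}W_{[n,i,j]}z^{-n-1}$. Two-sided matrix. Let $W=(w_{i,j})_{i,j\in\mathbb{Z}}$ be the banded matrix with $w_{i,j}=a_{\min(i,j)}^{(j-i)}$ if $-p\leq j-i\leq q$ and $w_{i,j}=0$ otherwise. It represents the operator $\mathcal{W}$ on $\mathcal{E}=\mathrm{span}\{e_n\}_{n\in\mathbb{Z}}$, $\langle\mathcal{W}e_j,e_i\rangle=w_{i,j}$,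 where $\{e_n\}$ is the standard basis of $\ell^2(\mathbb{Z})$. Put $$\psi_{i,j}(z)=\sum_{n=0}^{\infty}\frac{\langle\mathcal{W}^ne_j,e_i\rangle}{z^{n+1}}=\sum_{n=0}^\infty\frac{(W^n)_{i,j}}{z^{n+1}},\qquad i,j\in\mathbb{Z}.$$ Let $W_1=(w_{i,j})_{i,j\leq -1}$, and let $\chi_{i,j}(z)=\sum_{n=0}^{\infty}(W_1^n)_{i,j}z^{-n-1}$ for $i,j\leq -1$. Let $H=(h_{i,j})_{i,j\geq 0}$ with $h_{i,j}=w_{i,j}$. The matrix $K$. $K=(K_{i,j})_{i,j\geq 0}$ has entries $$K_{i,j}=h_{i,j}+\sum_{l=1}^{p-i}\sum_{m=1}^{q-j}a^{(-(l+i))}_{-l}a^{(m+j)}_{-m}\chi_{-l,-m}(z),\qquad 0\leq i\leq p-1,\ 0\leq j\leq q-1,$$ and $K_{i,j}=h_{i,j}$ otherwise. Inverse. $\mathbb{C}((z^{-1}))$ is the field of formal series $\sum_{n\in\mathbb{Z}}a_nz^n$ with complex coefficients and only finitely many nonzero $a_n$ with $n>0$. Consider the ring (under usual matrix operations) of matrices $(f_{i,j}(z))_{i,j\geq 0}$ with entries in $\mathbb{C}((z^{-1}))$ such that (1) there is $d\in\mathbb{Z}$ with $\deg f_{i,j}\leq d$ for all $i,j$, where $\deg$ is the largest exponent with nonzero coefficient, and (2) for every $n\leq d$ and $j\geq 0$ there is $\ell\geq 0$ such that the coefficient of $z^n$ in $f_{i,j}$ is zero for all $i\geq\ell$. These are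 exactly the matrix representations of formal Laurent series in $z^{-1}$ (finitely many positive powers of $z$) whose coefficients are linear operators on $\mathrm{span}\{e_n\}_{n\geq 0}$. The matrix $zI-K$ is invertible in this ring, and $\zeta_{i,j}(z)$, $i,j\geq 0$, denotes the $(i,j)$-entry of $(zI-K)^{-1}$. *)

theory Defs
  imports
    "HOL-Computational_Algebra.Formal_Laurent_Series"
    "HOL-Algebra.Ring"
begin

unbundle fps_syntax

text \<open>
  The field of formal Laurent series in \<open>z\<^sup>-\<^sup>1\<close> is rendered by the type \<^typ>\<open>complex fls\<close>, whose
  indeterminate \<^const>\<open>fls_X\<close> stands for \<open>z\<^sup>-\<^sup>1\<close>. Hence \<open>z\<close> is \<^const>\<open>fls_X_inv\<close>, and the coefficient
  of \<open>z\<^sup>n\<close> in \<open>f\<close> is \<open>f $$ (- n)\<close>.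

  The given sequences are a function \<open>a :: int \<Rightarrow> int \<Rightarrow> complex\<close>, with \<open>a k n\<close> the \<open>n\<close>-th term of
  the \<open>k\<close>-th sequence. Only the values with \<open>- p \<le> k \<le> q\<close> are ever used.
\<close>

definition z_coeff :: "complex fls \<Rightarrow> int \<Rightarrow> complex" where
  "z_coeff f n = f $$ (- n)"

text \<open>The series \<open>\<Sum>n\<ge>0. c n * z ^ (- n - 1)\<close>.\<close>

definition moment_series :: "(nat \<Rightarrow> complex) \<Rightarrow> complex fls" where
  "moment_series c = fls_X * fps_to_fls (Abs_fps c)"

lemma z_coeff_moment_series:
  "z_coeff (moment_series c) k = (if k < 0 then c (nat (- k - 1)) else 0)"
  by (auto simp: z_coeff_def moment_series_def fls_X_times_conv_shift nat_diff_distrib)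


section \<open>Lattice paths\<close>

definition lattice_step :: "nat \<Rightarrow> nat \<Rightarrow> nat \<times> int \<Rightarrow> nat \<times> int \<Rightarrow> bool" where
  "lattice_step p q u v \<longleftrightarrow>
     fst v = Suc (fst u) \<and> - int p \<le> snd v - snd u \<and> snd v - snd u \<le> int q"

definition step_weight :: "(int \<Rightarrow> int \<Rightarrow> complex) \<Rightarrow> nat \<times> int \<Rightarrow> nat \<times> int \<Rightarrow> complex" where
  "step_weight a u v =
     (let m = snd u; m' = snd v in if m \<le> m' then a (m' - m) m else a (m' - m) m')"

text \<open>A path with \<open>k\<close> steps is given by the list of its \<open>k + 1\<close> vertices.\<close>

definition lattice_path :: "nat \<Rightarrow> nat \<Rightarrow> (nat \<times> int) list \<Rightarrow> bool" where
  "lattice_path p q \<gamma> \<longleftrightarrow> \<gamma> \<noteq> [] \<and> successively (lattice_step p q) \<gamma>"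

definition path_length :: "(nat \<times> int) list \<Rightarrow> nat" where
  "path_length \<gamma> = length \<gamma> - 1"

definition path_weight :: "(int \<Rightarrow> int \<Rightarrow> complex) \<Rightarrow> (nat \<times> int) list \<Rightarrow> complex" where
  "path_weight a \<gamma> = (\<Prod>k<path_length \<gamma>. step_weight a (\<gamma> ! k) (\<gamma> ! Suc k))"

definition paths :: "nat \<Rightarrow> nat \<Rightarrow> nat \<Rightarrow> int \<Rightarrow> int \<Rightarrow> (nat \<times> int) list set" where
  "paths p q n i j =
     {\<gamma>. lattice_path p q \<gamma> \<and> path_length \<gamma> = n \<and> hd \<gamma> = (0, i) \<and> last \<gamma> = (n, j)}"

lemma finite_paths: "finite (paths p q n i j)"
proof (rule finite_subset)
  have vertex: "fst (\<gamma> ! k) = k \<and> i - int p * int k \<le> snd (\<gamma> ! k) \<and> snd (\<gamma> ! k) \<le> i + int q * int k"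
    if "\<gamma> \<in> paths p q n i j" "k < length \<gamma>" for \<gamma> k
    using that(2)
  proof (induction k)
    case 0
    with that(1) show ?case by (auto simp: paths_def hd_conv_nth)
  next
    case (Suc k)
    then have "lattice_step p q (\<gamma> ! k) (\<gamma> ! Suc k)"
      using that(1) by (auto simp: paths_def lattice_path_def successively_conv_nth)
    with Suc show ?case by (auto simp: lattice_step_def algebra_simps)
  qed
  show "paths p q n i j \<subseteq>
     {\<gamma>. set \<gamma> \<subseteq> {0..n} \<times> {i - int p * int n..i + int q * int n} \<and> length \<gamma> \<le> Suc n}"
  proof (intro subsetI CollectI conjI)
    fix \<gamma> v assume \<gamma>: "\<gamma> \<in> paths p q n i j" and "v \<in> set \<gamma>"
    then obtain k where k: "k < length \<gamma>" "v = \<gamma> ! k" by (auto simp: in_set_conv_nth)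
    with \<gamma> have "k \<le> n" by (auto simp: paths_def path_length_def)
    then have "int p * int k \<le> int p * int n" "int q * int k \<le> int q * int n"
      by (auto intro: mult_left_mono)
    with vertex[OF \<gamma> k(1)] \<open>k \<le> n\<close> k(2)
    show "v \<in> {0..n} \<times> {i - int p * int n..i + int q * int n}"
      by (simp add: mem_Times_iff)
  qed (auto simp: paths_def path_length_def)
  show "finite {\<gamma>. set \<gamma> \<subseteq> {0..n} \<times> {i - int p * int n..i + int q * int n} \<and> length \<gamma> \<le> Suc n}"
    by (intro finite_lists_length_le) auto
qed

definition path_count :: "nat \<Rightarrow> nat \<Rightarrow> (int \<Rightarrow> int \<Rightarrow> complex) \<Rightarrow> nat \<Rightarrow> int \<Rightarrow> int \<Rightarrow> complex" where
  "path_count p q a n i j = (\<Sum>\<gamma>\<in>paths p q n i j. path_weight a \<gamma>)"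

definition path_series :: "nat \<Rightarrow> nat \<Rightarrow> (int \<Rightarrow> int \<Rightarrow> complex) \<Rightarrow> int \<Rightarrow> int \<Rightarrow> complex fls" where
  "path_series p q a i j = moment_series (\<lambda>n. path_count p q a n i j)"


section \<open>The two-sided banded matrix\<close>

text \<open>
  Matrices with rows and columns indexed by a possibly infinite set \<open>I\<close>. The sum ranges over the
  nonzero terms only; there are finitely many of these if the columns of \<open>B\<close> are finitely supported.
\<close>

definition mat_mult ::
    "'i set \<Rightarrow> ('i \<Rightarrow> 'i \<Rightarrow> complex) \<Rightarrow> ('i \<Rightarrow> 'i \<Rightarrow> complex) \<Rightarrow> 'i \<Rightarrow> 'i \<Rightarrow> complex" where
  "mat_mult I A B i j = (\<Sum>l | l \<in> I \<and> A i l * B l j \<noteq> 0. A i l * B l j)"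

primrec mat_pow :: "'i set \<Rightarrow> ('i \<Rightarrow> 'i \<Rightarrow> complex) \<Rightarrow> nat \<Rightarrow> 'i \<Rightarrow> 'i \<Rightarrow> complex" where
  "mat_pow I A 0 = (\<lambda>i j. if i = j then 1 else 0)"
| "mat_pow I A (Suc n) = mat_mult I A (mat_pow I A n)"

definition w_mat :: "nat \<Rightarrow> nat \<Rightarrow> (int \<Rightarrow> int \<Rightarrow> complex) \<Rightarrow> int \<Rightarrow> int \<Rightarrow> complex" where
  "w_mat p q a i j =
     (if - int p \<le> j - i \<and> j - i \<le> int q then a (j - i) (min i j) else 0)"

definition psi :: "nat \<Rightarrow> nat \<Rightarrow> (int \<Rightarrow> int \<Rightarrow> complex) \<Rightarrow> int \<Rightarrow> int \<Rightarrow> complex fls" where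
  "psi p q a i j = moment_series (\<lambda>n. mat_pow UNIV (w_mat p q a) n i j)"

text \<open>
  The operator represented by the matrix, on the finitely supported two-sided sequences, and the
  resulting expression of \<^const>\<open>psi\<close>. The coordinate at \<open>i\<close> of a sequence is its inner product
  with \<open>e i\<close>.
\<close>

definition basis_vec :: "int \<Rightarrow> int \<Rightarrow> complex" where
  "basis_vec j = (\<lambda>i. if i = j then 1 else 0)"

definition w_op :: "nat \<Rightarrow> nat \<Rightarrow> (int \<Rightarrow> int \<Rightarrow> complex) \<Rightarrow> (int \<Rightarrow> complex) \<Rightarrow> int \<Rightarrow> complex" where
  "w_op p q a x = (\<lambda>i. \<Sum>j | x j \<noteq> 0. x j * w_mat p q a i j)"

lemma w_op_basis_vec: "w_op p q a (basis_vec j) i = w_mat p q a i j"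
proof -
  have "{l. basis_vec j l \<noteq> 0} = {j}" by (auto simp: basis_vec_def)
  then show ?thesis by (simp add: w_op_def basis_vec_def)
qed

lemma finite_support_w_op:
  assumes "finite {j. x j \<noteq> 0}"
  shows "finite {i. w_op p q a x i \<noteq> 0}"
proof (rule finite_subset)
  show "{i. w_op p q a x i \<noteq> 0} \<subseteq> (\<Union>j\<in>{j. x j \<noteq> 0}. {j - int q..j + int p})"
  proof
    fix i assume "i \<in> {i. w_op p q a x i \<noteq> 0}"
    then have "(\<Sum>j | x j \<noteq> 0. x j * w_mat p q a i j) \<noteq> 0" by (simp add: w_op_def)
    then obtain j where "x j \<noteq> 0" "x j * w_mat p q a i j \<noteq> 0"
      by (rule sum.not_neutral_contains_not_neutral) simp
    then show "i \<in> (\<Union>j\<in>{j. x j \<noteq> 0}. {j - int q..j + int p})"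
      by (intro UN_I[of j]) (auto simp: w_mat_def split: if_splits)
  qed
qed (use assms in auto)

lemma w_op_pow_eq_mat_pow:
  "finite {i. mat_pow UNIV (w_mat p q a) n i j \<noteq> 0} \<and>
   (w_op p q a ^^ n) (basis_vec j) = (\<lambda>i. mat_pow UNIV (w_mat p q a) n i j)"
proof (induction n)
  case 0
  show ?case by (simp add: basis_vec_def)
next
  case (Suc n)
  define x where "x = (\<lambda>i. mat_pow UNIV (w_mat p q a) n i j)"
  have fin: "finite {l. x l \<noteq> 0}" and pow: "(w_op p q a ^^ n) (basis_vec j) = x"
    using Suc.IH by (simp_all add: x_def)
  have eq: "mat_pow UNIV (w_mat p q a) (Suc n) i j = w_op p q a x i" for i
  proof -
    have "mat_pow UNIV (w_mat p q a) (Suc n) i j =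
        (\<Sum>l | w_mat p q a i l * x l \<noteq> 0. w_mat p q a i l * x l)"
      by (simp add: mat_mult_def x_def)
    also have "\<dots> = (\<Sum>l | x l \<noteq> 0. w_mat p q a i l * x l)"
      by (rule sum.mono_neutral_left) (use fin in auto)
    finally show ?thesis by (simp add: w_op_def mult.commute)
  qed
  show ?case
    using finite_support_w_op[OF fin] by (simp only: eq funpow.simps o_apply pow)
qed

lemma psi_eq_operator:
  "psi p q a i j = moment_series (\<lambda>n. (w_op p q a ^^ n) (basis_vec j) i)"
  by (simp add: psi_def w_op_pow_eq_mat_pow)


section \<open>The matrix \<open>K\<close>\<close>

definition chi :: "nat \<Rightarrow> nat \<Rightarrow> (int \<Rightarrow> int \<Rightarrow> complex) \<Rightarrow> int \<Rightarrow> int \<Rightarrow> complex fls" where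
  "chi p q a i j = moment_series (\<lambda>n. mat_pow {..-1} (w_mat p q a) n i j)"

definition h_mat :: "nat \<Rightarrow> nat \<Rightarrow> (int \<Rightarrow> int \<Rightarrow> complex) \<Rightarrow> nat \<Rightarrow> nat \<Rightarrow> complex" where
  "h_mat p q a i j = w_mat p q a (int i) (int j)"

definition K_mat :: "nat \<Rightarrow> nat \<Rightarrow> (int \<Rightarrow> int \<Rightarrow> complex) \<Rightarrow> nat \<Rightarrow> nat \<Rightarrow> complex fls" where
  "K_mat p q a i j =
     (if i < p \<and> j < q then
        fls_const (h_mat p q a i j) +
        (\<Sum>l=1..p - i. \<Sum>m=1..q - j.
           fls_const (a (- (int l + int i)) (- int l) * a (int m + int j) (- int m)) *
           chi p q a (- int l) (- int m))
      else fls_const (h_mat p q a i j))"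

definition zI_minus_K :: "nat \<Rightarrow> nat \<Rightarrow> (int \<Rightarrow> int \<Rightarrow> complex) \<Rightarrow> nat \<Rightarrow> nat \<Rightarrow> complex fls" where
  "zI_minus_K p q a i j = (if i = j then fls_X_inv else 0) - K_mat p q a i j"


section \<open>The ring of matrices of formal Laurent series\<close>

text \<open>
  In the carrier, the first conjunct says that every entry has degree at most \<open>d\<close> (the zero series
  included). The entries of a product are sums over an infinite index set; for matrices in the
  carrier, each coefficient of such a sum has only finitely many nonzero contributions.
\<close>

definition laurent_mat_carrier :: "(nat \<Rightarrow> nat \<Rightarrow> complex fls) set" where
  "laurent_mat_carrier =
     {F. \<exists>d. (\<forall>i j. \<forall>n>d. z_coeff (F i j) n = 0) \<and>
             (\<forall>n\<le>d. \<forall>j. \<exists>l. \<forall>i\<ge>l. z_coeff (F i j) n = 0)}"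

definition laurent_mat_mult ::
    "(nat \<Rightarrow> nat \<Rightarrow> complex fls) \<Rightarrow> (nat \<Rightarrow> nat \<Rightarrow> complex fls) \<Rightarrow> nat \<Rightarrow> nat \<Rightarrow> complex fls" where
  "laurent_mat_mult F G i j =
     Abs_fls (\<lambda>n. \<Sum>l | (F i l * G l j) $$ n \<noteq> 0. (F i l * G l j) $$ n)"

definition laurent_mat_ring :: "(nat \<Rightarrow> nat \<Rightarrow> complex fls) ring" where
  "laurent_mat_ring =
     \<lparr>carrier = laurent_mat_carrier,
      mult = laurent_mat_mult,
      one = (\<lambda>i j. if i = j then 1 else 0),
      zero = (\<lambda>i j. 0),
      add = (\<lambda>F G i j. F i j + G i j)\<rparr>"

text \<open>
  The following facts show that this is a ring in which \<^const>\<open>zI_minus_K\<close> is invertible. A series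
  vanishes below \<open>d\<close> if it is \<open>z ^ (- d)\<close> times a power series in \<open>z\<^sup>-\<^sup>1\<close>.
\<close>

definition vanishes_below :: "complex fls \<Rightarrow> int \<Rightarrow> bool" where
  "vanishes_below f d \<longleftrightarrow> (\<forall>n<d. f $$ n = 0)"

lemma vanishes_below_mono: "vanishes_below f d \<Longrightarrow> e \<le> d \<Longrightarrow> vanishes_below f e"
  by (auto simp: vanishes_below_def)

lemma vanishes_below_zero [simp]: "vanishes_below 0 d"
  by (simp add: vanishes_below_def)

lemma vanishes_below_add: "vanishes_below f d \<Longrightarrow> vanishes_below g d \<Longrightarrow> vanishes_below (f + g) d"
  by (simp add: vanishes_below_def)

lemma vanishes_below_minus: "vanishes_below f d \<Longrightarrow> vanishes_below (- f) d"
  by (simp add: vanishes_below_def)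

lemma vanishes_below_diff: "vanishes_below f d \<Longrightarrow> vanishes_below g d \<Longrightarrow> vanishes_below (f - g) d"
  by (simp add: vanishes_below_def)

lemma vanishes_below_sum:
  "(\<And>x. x \<in> S \<Longrightarrow> vanishes_below (f x) d) \<Longrightarrow> vanishes_below (sum f S) d"
  by (induction S rule: infinite_finite_induct) (auto intro: vanishes_below_add)

lemma vanishes_below_mult:
  assumes "vanishes_below f d" "vanishes_below g e" "c \<le> d + e"
  shows "vanishes_below (f * g) c"
proof (cases "f = 0 \<or> g = 0")
  case False
  have "d \<le> fls_subdegree f" "e \<le> fls_subdegree g"
    using assms False by (auto intro!: fls_subdegree_geI simp: vanishes_below_def)
  then show ?thesis
    using assms(3) by (auto simp: vanishes_below_def intro!: fls_times_nth_eq0)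
qed auto

lemma vanishes_below_eqI: "(\<And>N. vanishes_below (f - g) N) \<Longrightarrow> f = g"
proof (rule fls_eqI)
  fix n assume "\<And>N. vanishes_below (f - g) N"
  from this[of "n + 1"] show "f $$ n = g $$ n" by (auto simp: vanishes_below_def)
qed

lemma laurent_mat_carrier_iff:
  "F \<in> laurent_mat_carrier \<longleftrightarrow>
     (\<exists>d. \<forall>i j. vanishes_below (F i j) d) \<and> (\<forall>N j. \<exists>l. \<forall>i\<ge>l. vanishes_below (F i j) N)"
  (is "_ \<longleftrightarrow> ?B \<and> ?C")
proof
  assume "F \<in> laurent_mat_carrier"
  then obtain d where 1: "\<forall>i j. \<forall>n>d. z_coeff (F i j) n = 0"
    and 2: "\<forall>n\<le>d. \<forall>j. \<exists>l. \<forall>i\<ge>l. z_coeff (F i j) n = 0"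
    by (auto simp: laurent_mat_carrier_def)
  have d: "vanishes_below (F i j) (- d)" for i j
    unfolding vanishes_below_def
  proof (intro allI impI)
    fix n :: int assume "n < - d"
    then show "F i j $$ n = 0" using 1[rule_format, of "- n" i j] by (simp add: z_coeff_def)
  qed
  moreover have "\<exists>l. \<forall>i\<ge>l. vanishes_below (F i j) N" for N j
  proof -
    have "\<forall>n\<in>{- d..<N}. eventually (\<lambda>i. F i j $$ n = 0) sequentially"
    proof
      fix n assume "n \<in> {- d..<N}"
      then show "eventually (\<lambda>i. F i j $$ n = 0) sequentially"
        using 2[rule_format, of "- n" j] by (simp add: z_coeff_def eventually_sequentially)
    qed
    then have "eventually (\<lambda>i. \<forall>n\<in>{- d..<N}. F i j $$ n = 0) sequentially"
      by (rule eventually_ball_finite[rotated]) simp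
    then obtain l where l: "\<And>i n. i \<ge> l \<Longrightarrow> n \<in> {- d..<N} \<Longrightarrow> F i j $$ n = 0"
      unfolding eventually_sequentially by blast
    have "vanishes_below (F i j) N" if "i \<ge> l" for i
      unfolding vanishes_below_def
    proof (intro allI impI)
      fix n assume "n < N"
      then show "F i j $$ n = 0"
        using l[OF that, of n] d[of i j] by (cases "n < - d") (auto simp: vanishes_below_def)
    qed
    then show ?thesis by blast
  qed
  ultimately show "?B \<and> ?C" by blast
next
  assume *: "?B \<and> ?C"
  then obtain d where d: "\<And>i j. vanishes_below (F i j) d" by blast
  show "F \<in> laurent_mat_carrier"
    unfolding laurent_mat_carrier_def
  proof (intro CollectI exI[of _ "- d"] conjI allI impI)
    fix i j n assume "n > - d"
    then show "z_coeff (F i j) n = 0" using d[of i j] by (simp add: z_coeff_def vanishes_below_def)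
  next
    fix n j
    obtain l where "\<forall>i\<ge>l. vanishes_below (F i j) (1 - n)" using * by blast
    then show "\<exists>l. \<forall>i\<ge>l. z_coeff (F i j) n = 0"
      by (intro exI[of _ l]) (simp add: z_coeff_def vanishes_below_def)
  qed
qed

lemma laurent_mat_carrier_bound:
  assumes "F \<in> laurent_mat_carrier"
  shows "\<exists>d\<le>0. \<forall>i j. vanishes_below (F i j) d"
proof -
  obtain d where d: "vanishes_below (F i j) d" for i j
    using assms by (auto simp: laurent_mat_carrier_iff)
  have "vanishes_below (F i j) (min d 0)" for i j
    using d by (rule vanishes_below_mono) simp
  then show ?thesis by (intro exI[of _ "min d 0"]) simp
qed

lemma laurent_mat_carrier_cols:
  assumes "F \<in> laurent_mat_carrier"
  shows "\<exists>l. \<forall>i j. i \<ge> l \<longrightarrow> j < J \<longrightarrow> vanishes_below (F i j) N"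
proof -
  have "\<forall>j\<in>{..<J}. eventually (\<lambda>i. vanishes_below (F i j) N) sequentially"
    using assms by (auto simp: laurent_mat_carrier_iff eventually_sequentially)
  then have "eventually (\<lambda>i. \<forall>j\<in>{..<J}. vanishes_below (F i j) N) sequentially"
    by (rule eventually_ball_finite[rotated]) simp
  then show ?thesis by (auto simp: eventually_sequentially)
qed

lemma laurent_mat_mult_truncate:
  assumes F: "\<And>l. vanishes_below (F i l) d"
    and G: "\<And>l. vanishes_below (G l j) e"
    and fin: "\<And>N. \<exists>L. \<forall>l\<ge>L. vanishes_below (G l j) N"
    and L: "\<And>l. l \<ge> L \<Longrightarrow> vanishes_below (G l j) (N - d)"
  shows "vanishes_below (laurent_mat_mult F G i j - (\<Sum>l<L. F i l * G l j)) N"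
proof -
  have eq: "(\<Sum>l | (F i l * G l j) $$ n \<noteq> 0. (F i l * G l j) $$ n) =
      (\<Sum>l<M. F i l * G l j) $$ n"
    if "\<And>l. l \<ge> M \<Longrightarrow> vanishes_below (G l j) (n + 1 - d)" for n M
  proof -
    have "(F i l * G l j) $$ n = 0" if "l \<ge> M" for l
      using vanishes_below_mult[OF F \<open>\<And>l. l \<ge> M \<Longrightarrow> vanishes_below (G l j) (n + 1 - d)\<close>[OF that],
        of "n + 1"]
      by (auto simp: vanishes_below_def)
    then have "(\<Sum>l | (F i l * G l j) $$ n \<noteq> 0. (F i l * G l j) $$ n) =
        (\<Sum>l<M. (F i l * G l j) $$ n)"
      by (intro sum.mono_neutral_left) (auto simp: not_le[symmetric])
    then show ?thesis by (simp add: fls_nth_sum)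
  qed
  have zero: "(\<Sum>l | (F i l * G l j) $$ n \<noteq> 0. (F i l * G l j) $$ n) = 0" if "n < d + e" for n
    using vanishes_below_mult[OF F G order_refl] that by (auto simp: vanishes_below_def)
  have nth: "laurent_mat_mult F G i j $$ n =
      (\<Sum>l | (F i l * G l j) $$ n \<noteq> 0. (F i l * G l j) $$ n)" for n
    unfolding laurent_mat_mult_def
    by (rule nth_Abs_fls_ex_lower_bound) (use zero in blast)
  show ?thesis
    unfolding vanishes_below_def
  proof (intro allI impI)
    fix n assume "n < N"
    have "vanishes_below (G l j) (n + 1 - d)" if "l \<ge> L" for l
      using L[OF that] by (rule vanishes_below_mono) (use \<open>n < N\<close> in simp)
    then show "(laurent_mat_mult F G i j - (\<Sum>l<L. F i l * G l j)) $$ n = 0"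
      using eq[of L n] by (simp add: nth)
  qed
qed

lemma vanishes_below_laurent_mat_mult:
  assumes G': "G \<in> laurent_mat_carrier"
    and F: "\<And>l. vanishes_below (F i l) d"
    and G: "\<And>l. vanishes_below (G l j) e"
    and "c \<le> d + e"
  shows "vanishes_below (laurent_mat_mult F G i j) c"
proof -
  have fin: "\<exists>L. \<forall>l\<ge>L. vanishes_below (G l j) N" for N
    using G' by (auto simp: laurent_mat_carrier_iff)
  have "vanishes_below (laurent_mat_mult F G i j - (\<Sum>l<0. F i l * G l j)) (d + e)"
    by (rule laurent_mat_mult_truncate[where F = F and G = G and e = e, OF F G fin]) (use G in simp)
  then show ?thesis using \<open>c \<le> d + e\<close> by (auto intro: vanishes_below_mono)
qed

lemma laurent_mat_mult_approx:
  assumes F: "\<And>l. vanishes_below (F i l) d" and G: "G \<in> laurent_mat_carrier"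
    and L: "\<And>l. l \<ge> L \<Longrightarrow> vanishes_below (G l j) (N - d)"
  shows "vanishes_below (laurent_mat_mult F G i j - (\<Sum>l<L. F i l * G l j)) N"
proof -
  obtain e where "\<And>i j. vanishes_below (G i j) e" using laurent_mat_carrier_bound[OF G] by blast
  moreover have "\<exists>L. \<forall>l\<ge>L. vanishes_below (G l j) N" for N
    using G by (auto simp: laurent_mat_carrier_iff)
  ultimately show ?thesis using F L by (intro laurent_mat_mult_truncate) auto
qed

lemma laurent_mat_mult_closed:
  assumes F: "F \<in> laurent_mat_carrier" and G: "G \<in> laurent_mat_carrier"
  shows "laurent_mat_mult F G \<in> laurent_mat_carrier"
proof -
  obtain d where d: "\<And>i j. vanishes_below (F i j) d" using laurent_mat_carrier_bound[OF F] by blast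
  obtain e where e: "\<And>i j. vanishes_below (G i j) e" using laurent_mat_carrier_bound[OF G] by blast
  have "vanishes_below (laurent_mat_mult F G i j) (d + e)" for i j
    by (rule vanishes_below_laurent_mat_mult[OF G d e]) simp
  moreover have "\<exists>K. \<forall>i\<ge>K. vanishes_below (laurent_mat_mult F G i j) N" for N j
  proof -
    obtain L where L: "\<And>l j'. l \<ge> L \<Longrightarrow> j' < Suc j \<Longrightarrow> vanishes_below (G l j') (N - d)"
      using laurent_mat_carrier_cols[OF G] by blast
    obtain K where K: "\<And>i l. i \<ge> K \<Longrightarrow> l < L \<Longrightarrow> vanishes_below (F i l) (N - e)"
      using laurent_mat_carrier_cols[OF F] by blast
    have "vanishes_below (laurent_mat_mult F G i j) N" if "i \<ge> K" for i
    proof -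
      have "vanishes_below (laurent_mat_mult F G i j - (\<Sum>l<L. F i l * G l j)) N"
        by (rule laurent_mat_mult_approx[OF d G]) (use L in simp)
      moreover have "vanishes_below (\<Sum>l<L. F i l * G l j) N"
        by (intro vanishes_below_sum vanishes_below_mult[OF K[OF that] e]) auto
      ultimately show ?thesis using vanishes_below_add by fastforce
    qed
    then show ?thesis by blast
  qed
  ultimately show ?thesis by (auto simp: laurent_mat_carrier_iff)
qed

lemma laurent_mat_mult_assoc:
  assumes F: "F \<in> laurent_mat_carrier" and G: "G \<in> laurent_mat_carrier"
    and H: "H \<in> laurent_mat_carrier"
  shows "laurent_mat_mult (laurent_mat_mult F G) H = laurent_mat_mult F (laurent_mat_mult G H)"
proof (intro ext vanishes_below_eqI)
  fix i j N
  obtain d where d: "\<And>i j. vanishes_below (F i j) d" "d \<le> 0" using laurent_mat_carrier_bound[OF F] by blast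
  obtain e where e: "\<And>i j. vanishes_below (G i j) e" "e \<le> 0" using laurent_mat_carrier_bound[OF G] by blast
  obtain c where c: "\<And>i j. vanishes_below (H i j) c" "c \<le> 0" using laurent_mat_carrier_bound[OF H] by blast
  obtain L where L: "\<And>l j'. l \<ge> L \<Longrightarrow> j' < Suc j \<Longrightarrow> vanishes_below (H l j') (N - d - e)"
    using laurent_mat_carrier_cols[OF H] by blast
  obtain M where M: "\<And>m l. m \<ge> M \<Longrightarrow> l < L \<Longrightarrow> vanishes_below (G m l) (N - c - d)"
    using laurent_mat_carrier_cols[OF G] by blast
  note FG = laurent_mat_mult_closed[OF F G] and GH = laurent_mat_mult_closed[OF G H]
  let ?S = "\<Sum>l<L. (\<Sum>m<M. F i m * G m l) * H l j"
  have "vanishes_below (laurent_mat_mult F G i l) (d + e)" for l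
    by (rule vanishes_below_laurent_mat_mult[OF G d(1) e(1)]) simp
  then have 1: "vanishes_below (laurent_mat_mult (laurent_mat_mult F G) H i j -
      (\<Sum>l<L. laurent_mat_mult F G i l * H l j)) N"
    by (rule laurent_mat_mult_approx[OF _ H]) (use L in \<open>simp add: diff_diff_eq\<close>)
  have 2: "vanishes_below (\<Sum>l<L. (laurent_mat_mult F G i l - (\<Sum>m<M. F i m * G m l)) * H l j) N"
  proof (rule vanishes_below_sum)
    fix l assume "l \<in> {..<L}"
    then have "vanishes_below (laurent_mat_mult F G i l - (\<Sum>m<M. F i m * G m l)) (N - c)"
      by (intro laurent_mat_mult_approx[OF d(1) G]) (use M in auto)
    then show "vanishes_below ((laurent_mat_mult F G i l - (\<Sum>m<M. F i m * G m l)) * H l j) N"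
      by (rule vanishes_below_mult[OF _ c(1)]) simp
  qed
  have GH_approx: "vanishes_below (laurent_mat_mult G H m j - (\<Sum>l<L. G m l * H l j)) (N - d)" for m
    by (rule laurent_mat_mult_approx[OF e(1) H]) (use L in simp)
  have "vanishes_below (laurent_mat_mult G H m j) (N - d)" if "m \<ge> M" for m
  proof -
    have "vanishes_below (\<Sum>l<L. G m l * H l j) (N - d)"
      by (intro vanishes_below_sum vanishes_below_mult[OF M[OF that] c(1)]) auto
    from vanishes_below_add[OF GH_approx[of m] this] show ?thesis by simp
  qed
  then have 3: "vanishes_below (laurent_mat_mult F (laurent_mat_mult G H) i j -
      (\<Sum>m<M. F i m * laurent_mat_mult G H m j)) N"
    by (rule laurent_mat_mult_approx[OF d(1) GH])
  have 4: "vanishes_below (\<Sum>m<M. F i m * (laurent_mat_mult G H m j - (\<Sum>l<L. G m l * H l j))) N"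
    by (intro vanishes_below_sum vanishes_below_mult[OF d(1) GH_approx]) simp
  have "?S = (\<Sum>m<M. F i m * (\<Sum>l<L. G m l * H l j))"
    unfolding sum_distrib_left sum_distrib_right
    by (subst sum.swap) (simp add: mult.assoc)
  then have eq: "laurent_mat_mult (laurent_mat_mult F G) H i j -
      laurent_mat_mult F (laurent_mat_mult G H) i j =
      (laurent_mat_mult (laurent_mat_mult F G) H i j - (\<Sum>l<L. laurent_mat_mult F G i l * H l j)) +
      (\<Sum>l<L. (laurent_mat_mult F G i l - (\<Sum>m<M. F i m * G m l)) * H l j) -
      ((laurent_mat_mult F (laurent_mat_mult G H) i j - (\<Sum>m<M. F i m * laurent_mat_mult G H m j)) +
       (\<Sum>m<M. F i m * (laurent_mat_mult G H m j - (\<Sum>l<L. G m l * H l j))))"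
    by (simp add: algebra_simps sum_subtractf)
  show "vanishes_below (laurent_mat_mult (laurent_mat_mult F G) H i j -
      laurent_mat_mult F (laurent_mat_mult G H) i j) N"
    unfolding eq by (rule vanishes_below_diff[OF vanishes_below_add[OF 1 2] vanishes_below_add[OF 3 4]])
qed

lemma laurent_mat_carrier_add:
  assumes F: "F \<in> laurent_mat_carrier" and G: "G \<in> laurent_mat_carrier"
  shows "(\<lambda>i j. F i j + G i j) \<in> laurent_mat_carrier"
proof -
  obtain d where d: "\<And>i j. vanishes_below (F i j) d" "d \<le> 0" using laurent_mat_carrier_bound[OF F] by blast
  obtain e where e: "\<And>i j. vanishes_below (G i j) e" "e \<le> 0" using laurent_mat_carrier_bound[OF G] by blast
  have "vanishes_below (F i j + G i j) (d + e)" for i j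
    by (intro vanishes_below_add vanishes_below_mono[OF d(1)] vanishes_below_mono[OF e(1)])
      (use d(2) e(2) in auto)
  moreover have "\<exists>K. \<forall>i\<ge>K. vanishes_below (F i j + G i j) N" for N j
  proof -
    obtain K where K: "\<And>i l. i \<ge> K \<Longrightarrow> l < Suc j \<Longrightarrow> vanishes_below (F i l) N"
      using laurent_mat_carrier_cols[OF F] by blast
    obtain L where L: "\<And>i l. i \<ge> L \<Longrightarrow> l < Suc j \<Longrightarrow> vanishes_below (G i l) N"
      using laurent_mat_carrier_cols[OF G] by blast
    show ?thesis using K L by (intro exI[of _ "max K L"]) (auto intro: vanishes_below_add)
  qed
  ultimately show ?thesis by (auto simp: laurent_mat_carrier_iff)
qed

lemma laurent_mat_carrier_minus:
  assumes "F \<in> laurent_mat_carrier"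
  shows "(\<lambda>i j. - F i j) \<in> laurent_mat_carrier"
  using assms unfolding laurent_mat_carrier_iff by (meson vanishes_below_minus)

lemma laurent_mat_carrier_scalar:
  "(\<lambda>i j. if i = j then f else 0) \<in> laurent_mat_carrier"
proof -
  have "vanishes_below (if i = j then f else 0) (fls_subdegree f)" for i j :: nat
    by (simp add: vanishes_below_def)
  moreover have "\<exists>l. \<forall>i\<ge>l. vanishes_below (if i = j then f else 0) N" for j :: nat and N
    by (intro exI[of _ "Suc j"]) simp
  ultimately show ?thesis unfolding laurent_mat_carrier_iff by blast
qed

lemma laurent_mat_mult_scalar_left:
  assumes "F \<in> laurent_mat_carrier"
  shows "laurent_mat_mult (\<lambda>i j. if i = j then f else 0) F = (\<lambda>i j. f * F i j)"
proof (intro ext vanishes_below_eqI)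
  fix i j N
  have d: "vanishes_below (if i = l then f else 0) (fls_subdegree f)" for i l :: nat
    by (simp add: vanishes_below_def)
  obtain L where L: "\<And>l j'. l \<ge> L \<Longrightarrow> j' < Suc j \<Longrightarrow> vanishes_below (F l j') (N - fls_subdegree f)"
    using laurent_mat_carrier_cols[OF assms] by blast
  have "vanishes_below (laurent_mat_mult (\<lambda>i j. if i = j then f else 0) F i j -
      (\<Sum>l<max L (Suc i). (if i = l then f else 0) * F l j)) N"
    by (rule laurent_mat_mult_approx[OF d assms]) (use L in simp)
  moreover have "(\<Sum>l<max L (Suc i). (if i = l then f else 0) * F l j) =
      (\<Sum>l<max L (Suc i). if i = l then f * F l j else 0)"
    by (rule sum.cong) auto
  moreover have "\<dots> = f * F i j" by (simp add: less_max_iff_disj)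
  ultimately show "vanishes_below (laurent_mat_mult (\<lambda>i j. if i = j then f else 0) F i j - f * F i j) N"
    by (simp only:)
qed

lemma laurent_mat_mult_scalar_right:
  assumes "F \<in> laurent_mat_carrier"
  shows "laurent_mat_mult F (\<lambda>i j. if i = j then f else 0) = (\<lambda>i j. F i j * f)"
proof (intro ext vanishes_below_eqI)
  fix i j N
  obtain d where d: "\<And>i j. vanishes_below (F i j) d" using laurent_mat_carrier_bound[OF assms] by blast
  have "vanishes_below (laurent_mat_mult F (\<lambda>i j. if i = j then f else 0) i j -
      (\<Sum>l<Suc j. F i l * (if l = j then f else 0))) N"
    by (rule laurent_mat_mult_approx[OF d laurent_mat_carrier_scalar]) simp
  moreover have "(\<Sum>l<Suc j. F i l * (if l = j then f else 0)) = F i j * f" by simp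
  ultimately show "vanishes_below (laurent_mat_mult F (\<lambda>i j. if i = j then f else 0) i j - F i j * f) N"
    by (simp only:)
qed

lemma laurent_mat_mult_add_left:
  assumes F: "F \<in> laurent_mat_carrier" and G: "G \<in> laurent_mat_carrier"
    and H: "H \<in> laurent_mat_carrier"
  shows "laurent_mat_mult (\<lambda>i j. F i j + G i j) H =
    (\<lambda>i j. laurent_mat_mult F H i j + laurent_mat_mult G H i j)"
proof (intro ext vanishes_below_eqI)
  fix i j N
  obtain d where d: "\<And>i j. vanishes_below (F i j) d" "d \<le> 0" using laurent_mat_carrier_bound[OF F] by blast
  obtain e where e: "\<And>i j. vanishes_below (G i j) e" "e \<le> 0" using laurent_mat_carrier_bound[OF G] by blast
  have d': "vanishes_below (F i j) (d + e)" and e': "vanishes_below (G i j) (d + e)" for i j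
    using vanishes_below_mono[OF d(1), of "d + e"] vanishes_below_mono[OF e(1), of "d + e"] d(2) e(2)
    by auto
  obtain L where L: "\<And>l j'. l \<ge> L \<Longrightarrow> j' < Suc j \<Longrightarrow> vanishes_below (H l j') (N - (d + e))"
    using laurent_mat_carrier_cols[OF H] by blast
  have L': "\<And>l. l \<ge> L \<Longrightarrow> vanishes_below (H l j) (N - (d + e))" using L by simp
  note 1 = laurent_mat_mult_approx[where F = F, OF d' H L', of L i]
    laurent_mat_mult_approx[where F = G, OF e' H L', of L i]
    laurent_mat_mult_approx[where F = "\<lambda>i j. F i j + G i j", OF vanishes_below_add[OF d' e'] H L', of L i]
  from vanishes_below_diff[OF 1(3) vanishes_below_add[OF 1(1,2)]]
  show "vanishes_below (laurent_mat_mult (\<lambda>i j. F i j + G i j) H i j -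
      (laurent_mat_mult F H i j + laurent_mat_mult G H i j)) N"
    by (simp add: algebra_simps sum.distrib)
qed

lemma laurent_mat_mult_add_right:
  assumes F: "F \<in> laurent_mat_carrier" and G: "G \<in> laurent_mat_carrier"
    and H: "H \<in> laurent_mat_carrier"
  shows "laurent_mat_mult H (\<lambda>i j. F i j + G i j) =
    (\<lambda>i j. laurent_mat_mult H F i j + laurent_mat_mult H G i j)"
proof (intro ext vanishes_below_eqI)
  fix i j N
  obtain d where d: "\<And>i j. vanishes_below (H i j) d" using laurent_mat_carrier_bound[OF H] by blast
  obtain K where K: "\<And>l j'. l \<ge> K \<Longrightarrow> j' < Suc j \<Longrightarrow> vanishes_below (F l j') (N - d)"
    using laurent_mat_carrier_cols[OF F] by blast
  obtain L where L: "\<And>l j'. l \<ge> L \<Longrightarrow> j' < Suc j \<Longrightarrow> vanishes_below (G l j') (N - d)"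
    using laurent_mat_carrier_cols[OF G] by blast
  let ?L = "max K L"
  have K': "\<And>l. l \<ge> ?L \<Longrightarrow> vanishes_below (F l j) (N - d)" using K by simp
  have L': "\<And>l. l \<ge> ?L \<Longrightarrow> vanishes_below (G l j) (N - d)" using L by simp
  note FG = laurent_mat_carrier_add[OF F G]
  note 1 = laurent_mat_mult_approx[where F = H, OF d F K', of ?L i]
    laurent_mat_mult_approx[where F = H, OF d G L', of ?L i]
    laurent_mat_mult_approx[where F = H, OF d FG vanishes_below_add[OF K' L'], of ?L i]
  from vanishes_below_diff[OF 1(3) vanishes_below_add[OF 1(1,2)]]
  show "vanishes_below (laurent_mat_mult H (\<lambda>i j. F i j + G i j) i j -
      (laurent_mat_mult H F i j + laurent_mat_mult H G i j)) N"
    by (simp add: algebra_simps sum.distrib)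
qed

lemma laurent_mat_ring_simps:
  "carrier laurent_mat_ring = laurent_mat_carrier"
  "F \<otimes>\<^bsub>laurent_mat_ring\<^esub> G = laurent_mat_mult F G"
  "\<one>\<^bsub>laurent_mat_ring\<^esub> = (\<lambda>i j. if i = j then 1 else 0)"
  "\<zero>\<^bsub>laurent_mat_ring\<^esub> = (\<lambda>i j. 0)"
  "F \<oplus>\<^bsub>laurent_mat_ring\<^esub> G = (\<lambda>i j. F i j + G i j)"
  by (simp_all add: laurent_mat_ring_def)

lemma ring_laurent_mat_ring: "Ring.ring laurent_mat_ring"
proof (intro ringI abelian_groupI monoidI)
  show "\<exists>y\<in>carrier laurent_mat_ring. y \<oplus>\<^bsub>laurent_mat_ring\<^esub> x = \<zero>\<^bsub>laurent_mat_ring\<^esub>"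
    if "x \<in> carrier laurent_mat_ring" for x
    using that laurent_mat_carrier_minus[of x]
    by (intro bexI[of _ "\<lambda>i j. - x i j"]) (simp_all add: laurent_mat_ring_simps)
qed (use laurent_mat_carrier_scalar[of 0] laurent_mat_carrier_scalar[of 1] in
  \<open>simp_all add: laurent_mat_ring_simps laurent_mat_carrier_add laurent_mat_mult_closed
    laurent_mat_mult_assoc laurent_mat_mult_scalar_left laurent_mat_mult_scalar_right
    laurent_mat_mult_add_left laurent_mat_mult_add_right add_ac\<close>)


text \<open>Inversion of \<open>1 - N\<close>, where the entries of \<open>N\<close> are divisible by \<^const>\<open>fls_X\<close>.\<close>

lemma laurent_mat_geometric:
  fixes N :: "nat \<Rightarrow> nat \<Rightarrow> complex fls"
  defines "R \<equiv> laurent_mat_ring"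
  assumes N: "N \<in> carrier R" and N1: "\<And>i j. vanishes_below (N i j) 1"
  shows "\<one>\<^bsub>R\<^esub> \<ominus>\<^bsub>R\<^esub> N \<in> Units R"
proof -
  interpret Ring.ring R unfolding R_def by (rule ring_laurent_mat_ring)
  note simps = laurent_mat_ring_simps[folded R_def]
  define S where "S n = rec_nat \<zero>\<^bsub>R\<^esub> (\<lambda>n s. s \<oplus>\<^bsub>R\<^esub> N [^]\<^bsub>R\<^esub> n) n" for n :: nat
  have S0: "S 0 = \<zero>\<^bsub>R\<^esub>" and SSuc: "S (Suc n) = S n \<oplus>\<^bsub>R\<^esub> N [^]\<^bsub>R\<^esub> n" for n
    by (simp_all add: S_def)
  have Npow: "N [^]\<^bsub>R\<^esub> n \<in> carrier R" for n :: nat using N by simp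
  have S: "S n \<in> carrier R" for n by (induction n) (use Npow in \<open>auto simp: S0 SSuc\<close>)
  have pow: "vanishes_below ((N [^]\<^bsub>R\<^esub> n) i j) (int n)" for n i j
  proof (induction n arbitrary: i j)
    case 0
    show ?case by (simp add: simps vanishes_below_def)
  next
    case (Suc n)
    have "vanishes_below (laurent_mat_mult (N [^]\<^bsub>R\<^esub> n) N i j) (int (Suc n))"
      by (rule vanishes_below_laurent_mat_mult[where d = "int n" and e = 1]) (use N N1 Suc in \<open>simp_all add: simps\<close>)
    then show ?case by (simp add: simps)
  qed
  define Z where "Z i j = Abs_fls (\<lambda>m. S (nat (m + 1)) i j $$ m)" for i j
  have step: "S (Suc n) i j $$ m = S n i j $$ m" if "m < int n" for n m i j
    using pow[of n i j] that by (simp add: SSuc simps vanishes_below_def)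
  have stable: "S (k + n) i j $$ m = S n i j $$ m" if "m < int n" for k n m i j
    by (induction k) (use that step in auto)
  have Z_nth: "Z i j $$ m = S (nat (m + 1)) i j $$ m" for i j m
    unfolding Z_def
  proof (rule nth_Abs_fls_ex_lower_bound, intro exI allI impI)
    fix m :: int assume "m < 0"
    then show "S (nat (m + 1)) i j $$ m = 0" by (simp add: S0 simps)
  qed
  have Z_S: "vanishes_below (Z i j - S n i j) (int n)" for i j n
    unfolding vanishes_below_def
  proof (intro allI impI)
    fix m assume m: "m < int n"
    show "(Z i j - S n i j) $$ m = 0"
    proof (cases "m < 0")
      case True
      then show ?thesis using stable[of m 0 n i j] by (simp add: Z_nth S0 simps)
    next
      case False
      then have "n - nat (m + 1) + nat (m + 1) = n" using m by simp
      then show ?thesis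
        using stable[of m "nat (m + 1)" "n - nat (m + 1)" i j] False by (simp add: Z_nth)
    qed
  qed
  have Z: "Z \<in> carrier R"
    unfolding simps laurent_mat_carrier_iff
  proof (intro conjI allI)
    show "\<exists>d. \<forall>i j. vanishes_below (Z i j) d"
      using Z_S[of _ _ 0] by (auto simp: S0 simps)
    fix M :: int and j
    obtain l where l: "\<forall>i\<ge>l. vanishes_below (S (nat M) i j) M"
      using S[of "nat M"] unfolding simps laurent_mat_carrier_iff by blast
    have "vanishes_below (Z i j) M" if "i \<ge> l" for i
      using vanishes_below_add[OF vanishes_below_mono[OF Z_S[of i j "nat M"], of M] l[rule_format, OF that]]
      by simp
    then show "\<exists>l. \<forall>i\<ge>l. vanishes_below (Z i j) M" by blast
  qed
  let ?U = "\<one>\<^bsub>R\<^esub> \<ominus>\<^bsub>R\<^esub> N"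
  have U: "?U \<in> carrier R" using N by simp
  have minus: "(\<ominus>\<^bsub>R\<^esub> F) = (\<lambda>i j. - F i j)" if "F \<in> carrier R" for F
  proof -
    have "(\<lambda>i j. - F i j) \<in> carrier R" using that laurent_mat_carrier_minus by (simp add: simps)
    then show ?thesis using that by (intro minus_equality) (simp_all add: simps)
  qed
  have a_minus: "F \<ominus>\<^bsub>R\<^esub> G = (\<lambda>i j. F i j - G i j)" if "F \<in> carrier R" "G \<in> carrier R" for F G
    using that by (simp add: a_minus_def minus) (simp add: simps)
  have U0: "vanishes_below (?U i j) 0" for i j
    using vanishes_below_mono[OF N1[of i j], of 0]
    by (simp add: a_minus[OF one_closed N]) (simp add: simps vanishes_below_def)
  have US: "?U \<otimes>\<^bsub>R\<^esub> S n = \<one>\<^bsub>R\<^esub> \<ominus>\<^bsub>R\<^esub> N [^]\<^bsub>R\<^esub> n \<and> S n \<otimes>\<^bsub>R\<^esub> ?U = \<one>\<^bsub>R\<^esub> \<ominus>\<^bsub>R\<^esub> N [^]\<^bsub>R\<^esub> n" for n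
  proof (induction n)
    case 0
    show ?case using U by (simp add: S0) (simp add: a_minus_def r_neg)
  next
    case (Suc n)
    have comm: "N \<otimes>\<^bsub>R\<^esub> N [^]\<^bsub>R\<^esub> n = N [^]\<^bsub>R\<^esub> Suc n"
      by (rule nat_pow_Suc2[OF N, symmetric])
    have 1: "?U \<otimes>\<^bsub>R\<^esub> N [^]\<^bsub>R\<^esub> n = N [^]\<^bsub>R\<^esub> n \<ominus>\<^bsub>R\<^esub> N [^]\<^bsub>R\<^esub> Suc n"
      using N Npow[of n] by (simp only: a_minus_def l_distr one_closed a_inv_closed l_one l_minus comm)
    have 2: "N [^]\<^bsub>R\<^esub> n \<otimes>\<^bsub>R\<^esub> ?U = N [^]\<^bsub>R\<^esub> n \<ominus>\<^bsub>R\<^esub> N [^]\<^bsub>R\<^esub> Suc n"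
      using N Npow[of n] by (simp add: a_minus_def r_distr r_minus)
    have 3: "(\<one>\<^bsub>R\<^esub> \<ominus>\<^bsub>R\<^esub> N [^]\<^bsub>R\<^esub> n) \<oplus>\<^bsub>R\<^esub> (N [^]\<^bsub>R\<^esub> n \<ominus>\<^bsub>R\<^esub> N [^]\<^bsub>R\<^esub> Suc n) = \<one>\<^bsub>R\<^esub> \<ominus>\<^bsub>R\<^esub> N [^]\<^bsub>R\<^esub> Suc n"
      using Npow[of n] Npow[of "Suc n"] by (simp only: a_minus one_closed) (simp add: simps)
    show ?case
      unfolding SSuc using U S[of n] Npow[of n] Suc
      by (simp only: r_distr l_distr 1 2 3)
  qed
  have "?U \<otimes>\<^bsub>R\<^esub> Z = \<one>\<^bsub>R\<^esub> \<and> Z \<otimes>\<^bsub>R\<^esub> ?U = \<one>\<^bsub>R\<^esub>"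
  proof -
    have eqs: "F = \<one>\<^bsub>R\<^esub>"
      if "F \<in> carrier R" and *: "\<And>n i j. vanishes_below ((F \<ominus>\<^bsub>R\<^esub> (\<one>\<^bsub>R\<^esub> \<ominus>\<^bsub>R\<^esub> N [^]\<^bsub>R\<^esub> n)) i j) (int n)" for F
    proof (intro ext vanishes_below_eqI)
      fix i j M
      have "vanishes_below ((F \<ominus>\<^bsub>R\<^esub> (\<one>\<^bsub>R\<^esub> \<ominus>\<^bsub>R\<^esub> N [^]\<^bsub>R\<^esub> nat M)) i j - (N [^]\<^bsub>R\<^esub> nat M) i j) (int (nat M))"
        by (intro vanishes_below_diff * pow)
      moreover have "(F \<ominus>\<^bsub>R\<^esub> (\<one>\<^bsub>R\<^esub> \<ominus>\<^bsub>R\<^esub> N [^]\<^bsub>R\<^esub> nat M)) i j - (N [^]\<^bsub>R\<^esub> nat M) i j = F i j - \<one>\<^bsub>R\<^esub> i j"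
        by (simp only: a_minus[OF that(1) minus_closed[OF one_closed Npow]])
          (simp add: a_minus[OF one_closed Npow])
      ultimately show "vanishes_below (F i j - \<one>\<^bsub>R\<^esub> i j) M"
        by (auto intro: vanishes_below_mono)
    qed
    have D: "Z \<ominus>\<^bsub>R\<^esub> S n \<in> carrier R" for n using Z S by simp
    have DZ: "vanishes_below ((Z \<ominus>\<^bsub>R\<^esub> S n) i j) (int n)" for n i j
      using Z_S Z S by (simp add: a_minus)
    have UZ: "?U \<otimes>\<^bsub>R\<^esub> Z \<ominus>\<^bsub>R\<^esub> (\<one>\<^bsub>R\<^esub> \<ominus>\<^bsub>R\<^esub> N [^]\<^bsub>R\<^esub> n) = ?U \<otimes>\<^bsub>R\<^esub> (Z \<ominus>\<^bsub>R\<^esub> S n)" for n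
    proof -
      have "?U \<otimes>\<^bsub>R\<^esub> (Z \<ominus>\<^bsub>R\<^esub> S n) = ?U \<otimes>\<^bsub>R\<^esub> Z \<ominus>\<^bsub>R\<^esub> ?U \<otimes>\<^bsub>R\<^esub> S n"
        using U Z S[of n] by (simp only: a_minus_def[of R Z] a_minus_def[of R "?U \<otimes>\<^bsub>R\<^esub> Z"]
            r_distr a_inv_closed r_minus)
      then show ?thesis using US by simp
    qed
    have ZU: "Z \<otimes>\<^bsub>R\<^esub> ?U \<ominus>\<^bsub>R\<^esub> (\<one>\<^bsub>R\<^esub> \<ominus>\<^bsub>R\<^esub> N [^]\<^bsub>R\<^esub> n) = (Z \<ominus>\<^bsub>R\<^esub> S n) \<otimes>\<^bsub>R\<^esub> ?U" for n
    proof -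
      have "(Z \<ominus>\<^bsub>R\<^esub> S n) \<otimes>\<^bsub>R\<^esub> ?U = Z \<otimes>\<^bsub>R\<^esub> ?U \<ominus>\<^bsub>R\<^esub> S n \<otimes>\<^bsub>R\<^esub> ?U"
        using U Z S[of n] by (simp only: a_minus_def[of R Z] a_minus_def[of R "Z \<otimes>\<^bsub>R\<^esub> ?U"]
            l_distr a_inv_closed l_minus)
      then show ?thesis using US by simp
    qed
    have "vanishes_below ((?U \<otimes>\<^bsub>R\<^esub> (Z \<ominus>\<^bsub>R\<^esub> S n)) i j) (int n)" for n i j
      unfolding simps
      by (rule vanishes_below_laurent_mat_mult[where d = 0 and e = "int n"]) (use D U0 DZ in \<open>simp_all add: simps\<close>)
    moreover have "vanishes_below (((Z \<ominus>\<^bsub>R\<^esub> S n) \<otimes>\<^bsub>R\<^esub> ?U) i j) (int n)" for n i j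
      unfolding simps
      by (rule vanishes_below_laurent_mat_mult[where d = "int n" and e = 0]) (use U U0 DZ in \<open>simp_all add: simps\<close>)
    ultimately show ?thesis using U Z by (intro conjI eqs) (simp_all add: UZ ZU)
  qed
  then show ?thesis using U Z unfolding Units_def by blast
qed

lemma vanishes_below_moment_series: "vanishes_below (moment_series c) 1"
  using z_coeff_moment_series[of c "- n" for n] by (simp add: z_coeff_def vanishes_below_def)

lemma vanishes_below_K_mat: "vanishes_below (K_mat p q a i j) 0"
proof -
  have c: "vanishes_below (fls_const x) 0" for x by (simp add: vanishes_below_def)
  have "vanishes_below (fls_const x * chi p q a k l) 0" for x k l
    by (rule vanishes_below_mult[OF c, of _ 1]) (simp_all add: chi_def vanishes_below_moment_series)
  then show ?thesis
    unfolding K_mat_def using c by (auto intro!: vanishes_below_add vanishes_below_sum)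
qed

theorem zI_minus_K_Units: "zI_minus_K p q a \<in> Units laurent_mat_ring"
proof -
  interpret Ring.ring laurent_mat_ring by (rule ring_laurent_mat_ring)
  let ?R = laurent_mat_ring
  define N where "N i j = fls_X * K_mat p q a i j" for i j
  have N1: "vanishes_below (N i j) 1" for i j
    unfolding N_def
    by (rule vanishes_below_mult[OF _ vanishes_below_K_mat, of _ 1]) (auto simp: vanishes_below_def)
  have "K_mat p q a i j = 0" if "i \<ge> Suc (j + p)" for i j
    using that by (simp add: K_mat_def h_mat_def w_mat_def)
  then have "\<forall>i\<ge>Suc (j + p). vanishes_below (N i j) M" for j M
    by (simp add: N_def)
  then have N: "N \<in> carrier ?R"
    using N1 unfolding laurent_mat_ring_simps laurent_mat_carrier_iff by blast
  let ?z = "\<lambda>i j. if i = j then fls_X_inv else 0" and ?x = "\<lambda>i j. if i = j then fls_X else 0"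
  have z: "?z \<in> carrier ?R" and x: "?x \<in> carrier ?R"
    using laurent_mat_carrier_scalar by (auto simp: laurent_mat_ring_simps)
  have X: "fls_X_inv * (fls_X * f) = f" "fls_X * (fls_X_inv * f) = f" for f :: "complex fls"
    by (simp_all add: fls_X_inv_times_conv_shift fls_X_times_conv_shift)
  have "?z \<otimes>\<^bsub>?R\<^esub> ?x = \<one>\<^bsub>?R\<^esub>" "?x \<otimes>\<^bsub>?R\<^esub> ?z = \<one>\<^bsub>?R\<^esub>"
    using X[of 1] laurent_mat_carrier_scalar
    by (auto simp: laurent_mat_ring_simps laurent_mat_mult_scalar_left fun_eq_iff)
  with z x have "?z \<in> Units ?R" unfolding Units_def by blast
  moreover have "\<one>\<^bsub>?R\<^esub> \<ominus>\<^bsub>?R\<^esub> N \<in> Units ?R"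
    by (rule laurent_mat_geometric[OF N N1])
  moreover have "?z \<otimes>\<^bsub>?R\<^esub> (\<one>\<^bsub>?R\<^esub> \<ominus>\<^bsub>?R\<^esub> N) = zI_minus_K p q a"
  proof -
    have "(\<lambda>i j. - N i j) \<in> carrier ?R"
      using N laurent_mat_carrier_minus by (simp add: laurent_mat_ring_simps)
    then have "\<ominus>\<^bsub>?R\<^esub> N = (\<lambda>i j. - N i j)"
      using N by (intro minus_equality) (simp_all add: laurent_mat_ring_simps)
    then have *: "\<one>\<^bsub>?R\<^esub> \<ominus>\<^bsub>?R\<^esub> N = (\<lambda>i j. (if i = j then 1 else 0) - N i j)"
      by (simp add: a_minus_def laurent_mat_ring_simps fun_eq_iff)
    have "\<one>\<^bsub>?R\<^esub> \<ominus>\<^bsub>?R\<^esub> N \<in> laurent_mat_carrier"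
      using N by (simp flip: laurent_mat_ring_simps(1))
    then show ?thesis
      by (auto simp: X laurent_mat_ring_simps(2) laurent_mat_mult_scalar_left * fun_eq_iff
          zI_minus_K_def N_def right_diff_distrib)
  qed
  ultimately show ?thesis using Units_m_closed by metis
qed

definition zeta :: "nat \<Rightarrow> nat \<Rightarrow> (int \<Rightarrow> int \<Rightarrow> complex) \<Rightarrow> nat \<Rightarrow> nat \<Rightarrow> complex fls" where
  "zeta p q a = inv\<^bsub>laurent_mat_ring\<^esub> (zI_minus_K p q a)"

end

theory Submission
  imports Defs
begin

text \<open>
  Splitting off the last step of a path shows that path counts are entries of powers of the banded
  matrix. The columns of \<open>(z - W)\<^sup>-\<^sup>1\<close> solve a linear system over \<open>\<int>\<close>. Its rows of negative index
  express the negative part of a column through the nonnegative part by means of \<^const>\<open>chi\<close>, and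
  substituting this in the remaining rows leaves \<open>z - K\<close>: this matrix is the Schur complement of
  \<open>z - W\<^sub>1\<close>. Solutions of all these systems are unique among families of series with
  a common bound on their degrees, because \<open>z\<^sup>-\<^sup>1\<close> raises the order at \<open>z = \<infinity>\<close>.
\<close>

subsection \<open>Linear systems over formal Laurent series\<close>

lemma fls_X_times_X_inv_times: "fls_X * (fls_X_inv * f) = (f :: complex fls)"
  by (simp add: fls_X_inv_times_conv_shift fls_X_times_conv_shift)

text \<open>Dividing the system by z writes each \<open>g i\<close> as \<open>fls_X\<close> times a
  combination of other \<open>g l\<close> with coefficients of order at least 0. A lower bound on
  the order shared by all of \<open>I\<close> therefore improves by one, again for all of
  \<open>I\<close>, and iteration forces \<open>g i\<close> to vanish.\<close>

lemma fls_X_inv_system_trivial: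
  assumes eq: "\<And>i. i \<in> I \<Longrightarrow> fls_X_inv * g i = (\<Sum>l\<in>S i. M i l * g l)"
    and S: "\<And>i. i \<in> I \<Longrightarrow> S i \<subseteq> I"
    and M: "\<And>i l. vanishes_below (M i l) 0"
    and g: "\<And>i. i \<in> I \<Longrightarrow> vanishes_below (g i) d"
    and "i \<in> I"
  shows "g i = 0"
proof -
  have *: "vanishes_below (g i) (d + int n)" if "i \<in> I" for i n
    using that
  proof (induction n arbitrary: i)
    case 0
    then show ?case using g by simp
  next
    case (Suc n)
    have sum: "vanishes_below (\<Sum>l\<in>S i. M i l * g l) (d + int n)"
      using Suc S by (intro vanishes_below_sum vanishes_below_mult[OF M Suc.IH]) auto
    have "vanishes_below fls_X 1"
      by (simp add: vanishes_below_def)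
    then have "vanishes_below (fls_X * (\<Sum>l\<in>S i. M i l * g l)) (d + int (Suc n))"
      using sum by (rule vanishes_below_mult) simp
    also have "fls_X * (\<Sum>l\<in>S i. M i l * g l) = g i"
      using eq[OF Suc.prems] fls_X_times_X_inv_times[of "g i"] by simp
    finally show ?case .
  qed
  show ?thesis
  proof (rule vanishes_below_eqI)
    fix N
    show "vanishes_below (g i - 0) N"
      using vanishes_below_mono[OF *[OF \<open>i \<in> I\<close>, of "nat (N - d)"], of N] by simp
  qed
qed

lemma vanishes_below_fls_const: "vanishes_below (fls_const c) 0"
  by (simp add: vanishes_below_def)

lemma sum_int_atLeast0_lessThan: "(\<Sum>x\<in>{0..<int n}. f x) = (\<Sum>l<n. f (int l))"
  by (simp add: sum.reindex lessThan_atLeast0 flip: image_int_atLeastLessThan[of 0 n, simplified])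

lemma moment_series_nth: "moment_series c $$ n = (if n > 0 then c (nat (n - 1)) else 0)"
  using z_coeff_moment_series[of c "- n"] by (simp add: z_coeff_def)

text \<open>This turns a recursion for moments into a linear equation over the series: the zeroth
  moment becomes the inhomogeneous term.\<close>

lemma moment_series_shift:
  "fls_X_inv * moment_series c = fls_const (c 0) + moment_series (\<lambda>n. c (Suc n))"
  by (rule fls_eqI) (auto simp: fls_X_inv_times_conv_shift moment_series_nth
      Suc_nat_eq_nat_zadd1 dest: order_antisym)

lemma moment_series_sum:
  "moment_series (\<lambda>n. \<Sum>l\<in>S. k l * c l n) = (\<Sum>l\<in>S. fls_const (k l) * moment_series (c l))"
  by (rule fls_eqI) (simp add: moment_series_nth fls_nth_sum)

text \<open>The product is defined coefficientwise, so equality is checked to every order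
  \<open>N\<close>. The cutoff \<open>M\<close> depends on \<open>N\<close>, but beyond
  \<open>L\<close> the extra terms are zero.\<close>

lemma laurent_mat_mult_finite_row:
  assumes F: "\<And>l. vanishes_below (F i l) d" and G: "G \<in> laurent_mat_carrier"
    and row: "\<And>l. l \<ge> L \<Longrightarrow> F i l = 0"
  shows "laurent_mat_mult F G i j = (\<Sum>l<L. F i l * G l j)"
proof (rule vanishes_below_eqI)
  fix N
  obtain M where M: "\<And>l. l \<ge> M \<Longrightarrow> vanishes_below (G l j) (N - d)"
    using G unfolding laurent_mat_carrier_iff by blast
  have "(\<Sum>l<max L M. F i l * G l j) = (\<Sum>l<L. F i l * G l j)"
    using row by (intro sum.mono_neutral_right) auto
  with laurent_mat_mult_approx[of F i d, OF F G, of "max L M" j N] M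
  show "vanishes_below (laurent_mat_mult F G i j - (\<Sum>l<L. F i l * G l j)) N"
    by simp
qed

subsection \<open>Powers of the banded matrix\<close>

lemma mat_mult_w_mat:
  "mat_mult I (w_mat p q a) B i j = (\<Sum>l\<in>I \<inter> {i - int p..i + int q}. w_mat p q a i l * B l j)"
  unfolding mat_mult_def by (rule sum.mono_neutral_left) (auto simp: w_mat_def split: if_splits)

text \<open>\<open>mat_pow\<close> multiplies by W on the left, whereas removing the last step of a
  path needs W on the right. The bands make all sums finite, so the induction only swaps
  them.\<close>

lemma mat_pow_w_mat_Suc_right:
  "mat_pow UNIV (w_mat p q a) (Suc n) i j =
     (\<Sum>l\<in>{j - int q..j + int p}. mat_pow UNIV (w_mat p q a) n i l * w_mat p q a l j)"
proof (induction n arbitrary: i)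
  case 0
  have "(\<Sum>l\<in>{j - int q..j + int p}. (if i = l then 1 else 0) * w_mat p q a l j) =
      (\<Sum>l\<in>{j - int q..j + int p}. if i = l then w_mat p q a l j else 0)"
    by (rule sum.cong) auto
  moreover have "(\<Sum>l\<in>{i - int p..i + int q}. w_mat p q a i l * (if l = j then 1 else 0)) =
      (\<Sum>l\<in>{i - int p..i + int q}. if l = j then w_mat p q a i l else 0)"
    by (rule sum.cong) auto
  moreover have "w_mat p q a i j = 0" if "i \<notin> {j - int q..j + int p}"
    using that by (auto simp: w_mat_def)
  ultimately show ?case by (auto simp: mat_mult_w_mat)
next
  case (Suc n)
  have "mat_pow UNIV (w_mat p q a) (Suc (Suc n)) i j =
      (\<Sum>l\<in>{i - int p..i + int q}. w_mat p q a i l *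
        (\<Sum>m\<in>{j - int q..j + int p}. mat_pow UNIV (w_mat p q a) n l m * w_mat p q a m j))"
    by (subst mat_pow.simps(2)) (simp add: mat_mult_w_mat Suc.IH[symmetric] del: mat_pow.simps)
  also have "\<dots> = (\<Sum>m\<in>{j - int q..j + int p}.
      (\<Sum>l\<in>{i - int p..i + int q}. w_mat p q a i l * mat_pow UNIV (w_mat p q a) n l m) *
      w_mat p q a m j)"
    unfolding sum_distrib_left sum_distrib_right
    by (subst sum.swap) (simp add: mult.assoc)
  finally show ?case by (simp add: mat_mult_w_mat)
qed

lemma w_mat_eq_step_weight:
  "- int p \<le> j - i \<Longrightarrow> j - i \<le> int q \<Longrightarrow> w_mat p q a i j = step_weight a (n, i) (n', j)"
  by (simp add: w_mat_def step_weight_def min_def)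

subsection \<open>Lattice paths\<close>

lemma paths_0: "paths p q 0 i j = (if i = j then {[(0, i)]} else {})"
proof -
  have "\<gamma> \<in> paths p q 0 i j \<longleftrightarrow> \<gamma> = [(0, i)] \<and> i = j" for \<gamma>
  proof (cases \<gamma>)
    case (Cons v \<beta>)
    then show ?thesis by (cases \<beta>) (auto simp: paths_def lattice_path_def path_length_def)
  qed (simp add: paths_def lattice_path_def)
  then show ?thesis by auto
qed

lemma paths_Suc:
  "paths p q (Suc n) i j =
     (\<Union>l\<in>{j - int q..j + int p}. (\<lambda>\<gamma>. \<gamma> @ [(Suc n, j)]) ` paths p q n i l)"
proof (intro equalityI subsetI)
  fix \<gamma> assume \<gamma>: "\<gamma> \<in> paths p q (Suc n) i j"
  define \<beta> where "\<beta> = butlast \<gamma>"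
  have \<beta>: "\<gamma> = \<beta> @ [(Suc n, j)]"
    using \<gamma> append_butlast_last_id[of \<gamma>] by (simp add: \<beta>_def paths_def lattice_path_def)
  have len: "length \<beta> = Suc n" using \<gamma> by (simp add: \<beta> paths_def path_length_def)
  then have ne: "\<beta> \<noteq> []" by auto
  have succ: "successively (lattice_step p q) \<beta>" and st: "lattice_step p q (last \<beta>) (Suc n, j)"
    using \<gamma> ne by (auto simp: \<beta> paths_def lattice_path_def successively_append_iff)
  have last: "last \<beta> = (n, snd (last \<beta>))" using st by (simp add: lattice_step_def prod_eq_iff)
  have "\<beta> \<in> paths p q n i (snd (last \<beta>))"
    using \<gamma> succ ne len last by (simp add: paths_def lattice_path_def path_length_def \<beta>)
  moreover have "snd (last \<beta>) \<in> {j - int q..j + int p}" using st by (simp add: lattice_step_def)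
  ultimately show "\<gamma> \<in> (\<Union>l\<in>{j - int q..j + int p}. (\<lambda>\<gamma>. \<gamma> @ [(Suc n, j)]) ` paths p q n i l)"
    using \<beta> by blast
next
  fix \<gamma> assume "\<gamma> \<in> (\<Union>l\<in>{j - int q..j + int p}. (\<lambda>\<gamma>. \<gamma> @ [(Suc n, j)]) ` paths p q n i l)"
  then show "\<gamma> \<in> paths p q (Suc n) i j"
    by (auto simp: paths_def lattice_path_def path_length_def successively_append_iff
        lattice_step_def)
qed

lemma path_weight_snoc:
  assumes "\<gamma> \<noteq> []"
  shows "path_weight a (\<gamma> @ [v]) = path_weight a \<gamma> * step_weight a (last \<gamma>) v"
proof -
  obtain n where n: "length \<gamma> = Suc n" using assms by (cases \<gamma>) auto
  then show ?thesis
    using assms by (simp add: path_weight_def path_length_def nth_append last_conv_nth)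
qed

lemma path_count_eq_mat_pow: "path_count p q a n i j = mat_pow UNIV (w_mat p q a) n i j"
proof (induction n arbitrary: j)
  case 0
  show ?case by (simp add: path_count_def paths_0 path_weight_def path_length_def)
next
  case (Suc n)
  have inj: "inj_on (\<lambda>\<gamma>. \<gamma> @ [(Suc n, j)]) A" for A by (auto simp: inj_on_def)
  have "path_count p q a (Suc n) i j =
      (\<Sum>l\<in>{j - int q..j + int p}. \<Sum>\<gamma>\<in>paths p q n i l. path_weight a (\<gamma> @ [(Suc n, j)]))"
    unfolding path_count_def paths_Suc
    \<comment> \<open>The union is disjoint because \<open>l\<close> is the height of the
      next-to-last vertex.\<close>
    by (subst sum.UNION_disjoint)
      (use finite_paths in \<open>auto simp: sum.reindex[OF inj] paths_def\<close>)
  also have "\<dots> = (\<Sum>l\<in>{j - int q..j + int p}. path_count p q a n i l * w_mat p q a l j)"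
    unfolding path_count_def sum_distrib_right
  proof (intro sum.cong refl)
    fix l \<gamma> assume l: "l \<in> {j - int q..j + int p}" and "\<gamma> \<in> paths p q n i l"
    then have "\<gamma> \<noteq> []" "last \<gamma> = (n, l)" by (auto simp: paths_def lattice_path_def)
    then show "path_weight a (\<gamma> @ [(Suc n, j)]) = path_weight a \<gamma> * w_mat p q a l j"
      using l by (simp add: path_weight_snoc w_mat_eq_step_weight[where n = n and n' = "Suc n"])
  qed
  finally show ?case by (simp only: Suc.IH mat_pow_w_mat_Suc_right)
qed

subsection \<open>The Schur complement\<close>

text \<open>Coefficientwise this is the recursion for the powers of the section of W over
  \<open>I\<close>, so it serves both \<open>psi\<close> and \<open>chi\<close>. Leaving
  \<open>S\<close> free lets each use pick a set that splits well at 0.\<close>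

lemma resolvent_equation:
  fixes p q :: nat and a I
  defines "R \<equiv> \<lambda>i j. moment_series (\<lambda>n. mat_pow I (w_mat p q a) n i j)"
  assumes "finite S" "S \<subseteq> I" "I \<inter> {i - int p..i + int q} \<subseteq> S"
  shows "fls_X_inv * R i j =
    (if i = j then 1 else 0) + (\<Sum>l\<in>S. fls_const (w_mat p q a i l) * R l j)"
proof -
  have "mat_pow I (w_mat p q a) (Suc n) i j =
      (\<Sum>l\<in>S. w_mat p q a i l * mat_pow I (w_mat p q a) n l j)" for n
    using assms by (subst mat_pow.simps, subst mat_mult_w_mat, intro sum.mono_neutral_left)
      (auto simp: w_mat_def split: if_splits)
  then show ?thesis
    unfolding R_def by (simp only: moment_series_shift moment_series_sum mat_pow.simps(1)) simp
qed

text \<open>On negative indices a column of \<open>psi\<close> solves (z - W1) x = b, where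
  \<open>b\<close> collects the coupling to the nonnegative entries. As \<open>chi\<close> is the
  resolvent of W1, the column \<open>f\<close> solves the same system, and the two agree by
  uniqueness.\<close>

lemma psi_negative_row:
  assumes "r < 0" and "j \<ge> 0"
  shows "psi p q a r j = (\<Sum>s\<in>{- int q..-1}. chi p q a r s *
    (\<Sum>l<q. fls_const (w_mat p q a s (int l)) * psi p q a (int l) j))"
proof -
  define b where "b s = (\<Sum>l<q. fls_const (w_mat p q a s (int l)) * psi p q a (int l) j)" for s
  define f where "f r = (\<Sum>s\<in>{- int q..-1}. chi p q a r s * b s)" for r
  let ?B = "\<lambda>r. {..-1} \<inter> {r - int p..r + int q}"
  have psi: "fls_X_inv * psi p q a r j =
      b r + (\<Sum>t\<in>?B r. fls_const (w_mat p q a r t) * psi p q a t j)" if "r < 0" for r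
  proof -
    \<comment> \<open>A row \<open>r < 0\<close> reaches no column beyond \<open>r + q < q\<close>,
      and the Kronecker delta drops out since \<open>j\<close> is nonnegative.\<close>
    have "fls_X_inv * psi p q a r j =
        (\<Sum>l\<in>{0..<int q} \<union> ?B r. fls_const (w_mat p q a r l) * psi p q a l j)"
      using that \<open>j \<ge> 0\<close> unfolding psi_def
      by (subst resolvent_equation[where S = "{0..<int q} \<union> ?B r"]) auto
    also have "\<dots> = b r + (\<Sum>t\<in>?B r. fls_const (w_mat p q a r t) * psi p q a t j)"
      by (subst sum.union_disjoint) (auto simp: b_def sum_int_atLeast0_lessThan)
    finally show ?thesis .
  qed
  \<comment> \<open>Hence restricting \<open>s\<close> to \<open>{- int q..-1}\<close> in
    \<open>f\<close> loses nothing, even for rows \<open>r\<close> outside this range.\<close>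
  have b0: "b r = 0" if "r < - int q" for r
    using that by (simp add: b_def w_mat_def)
  have f: "fls_X_inv * f r = b r + (\<Sum>t\<in>?B r. fls_const (w_mat p q a r t) * f t)" if "r < 0" for r
  proof -
    have "fls_X_inv * f r = (\<Sum>s\<in>{- int q..-1}. (fls_X_inv * chi p q a r s) * b s)"
      by (simp add: f_def sum_distrib_left mult.assoc)
    also have "\<dots> = (\<Sum>s\<in>{- int q..-1}. (if r = s then b s else 0) +
        (\<Sum>t\<in>?B r. fls_const (w_mat p q a r t) * chi p q a t s * b s))"
      unfolding chi_def
      by (intro sum.cong refl, subst resolvent_equation[where S = "?B r"])
        (auto simp: distrib_right sum_distrib_right)
    also have "\<dots> = (\<Sum>s\<in>{- int q..-1}. if r = s then b s else 0) +
        (\<Sum>t\<in>?B r. fls_const (w_mat p q a r t) * f t)"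
      unfolding sum.distrib f_def sum_distrib_left by (subst sum.swap) (simp add: mult.assoc)
    also have "(\<Sum>s\<in>{- int q..-1}. if r = s then b s else 0) = b r"
      using b0[of r] that by auto
    finally show ?thesis .
  qed
  have v: "vanishes_below (psi p q a r j) 0" "vanishes_below (chi p q a r s) 0" for r j s
    unfolding psi_def chi_def by (rule vanishes_below_mono[OF vanishes_below_moment_series]; simp)+
  have "vanishes_below (f r) 0" for r
    unfolding f_def b_def
    by (intro vanishes_below_sum vanishes_below_mult[OF v(2)]
        vanishes_below_mult[OF vanishes_below_fls_const v(1)]) auto
  with v have "vanishes_below (psi p q a r j - f r) 0" for r
    by (intro vanishes_below_diff)
  then have "psi p q a r j - f r = 0"
    using \<open>r < 0\<close>
    by (intro fls_X_inv_system_trivial[where I = "{..<0}" and S = ?B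
          and M = "\<lambda>r t. fls_const (w_mat p q a r t)" and d = 0])
      (auto simp: right_diff_distrib psi f sum_subtractf vanishes_below_fls_const)
  then show ?thesis by (simp add: f_def b_def)
qed

text \<open>The upper limits \<open>p - i\<close> and \<open>q - j\<close> only discard entries of W
  outside the band. The correction is thus the full product of the two off-diagonal blocks of W with
  \<open>chi\<close> between them.\<close>

lemma K_mat_eq:
  "K_mat p q a i j = fls_const (w_mat p q a (int i) (int j)) +
     (\<Sum>r\<in>{- int p..-1}. \<Sum>s\<in>{- int q..-1}.
        fls_const (w_mat p q a (int i) r * w_mat p q a s (int j)) * chi p q a r s)"
proof -
  let ?g = "\<lambda>r s. fls_const (w_mat p q a (int i) r * w_mat p q a s (int j)) * chi p q a r s"
  have reindex: "(\<Sum>r\<in>{- int n..-1}. h r) = (\<Sum>l=1..n. h (- int l))" for n and h :: "int \<Rightarrow> complex fls"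
    by (rule sum.reindex_bij_witness[of _ "\<lambda>l. - int l" "\<lambda>r. nat (- r)"]) auto
  have "(\<Sum>l=1..p. \<Sum>m=1..q. ?g (- int l) (- int m)) =
      (\<Sum>l=1..p - i. \<Sum>m=1..q - j. ?g (- int l) (- int m))"
  proof -
    have "(\<Sum>m=1..q. ?g (- int l) (- int m)) = (\<Sum>m=1..q - j. ?g (- int l) (- int m))" for l
      by (rule sum.mono_neutral_right) (auto simp: w_mat_def)
    moreover have "(\<Sum>l=1..p. \<Sum>m=1..q - j. ?g (- int l) (- int m)) =
        (\<Sum>l=1..p - i. \<Sum>m=1..q - j. ?g (- int l) (- int m))"
      by (rule sum.mono_neutral_right) (auto simp: w_mat_def)
    ultimately show ?thesis by simp
  qed
  also have "\<dots> = (\<Sum>l=1..p - i. \<Sum>m=1..q - j.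
      fls_const (a (- (int l + int i)) (- int l) * a (int m + int j) (- int m)) *
      chi p q a (- int l) (- int m))"
    by (intro sum.cong refl) (auto simp: w_mat_def algebra_simps min_def)
  \<comment> \<open>In the second case of \<open>K_mat\<close>, truncated subtraction makes
    \<open>p - i\<close> or \<open>q - j\<close> zero, so the double sum is empty.\<close>
  finally show ?thesis
    by (auto simp: reindex K_mat_def h_mat_def)
qed

lemma K_mat_eq_0: "l \<ge> Suc (i + q) \<Longrightarrow> K_mat p q a i l = 0"
  by (simp add: K_mat_def h_mat_def w_mat_def)

lemma psi_K_mat_equation:
  "fls_X_inv * psi p q a (int i) (int j) = (if i = j then 1 else 0) +
     (\<Sum>l<Suc (i + q). K_mat p q a i l * psi p q a (int l) (int j))"
proof -
  let ?L = "Suc (i + q)" and ?P = "\<lambda>r. psi p q a r (int j)"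
  let ?w = "\<lambda>r s. fls_const (w_mat p q a r s)"
  have "fls_X_inv * ?P (int i) = (if i = j then 1 else 0) +
      (\<Sum>l\<in>{0..<int ?L} \<union> {- int p..-1}. ?w (int i) l * ?P l)"
    unfolding psi_def
    by (subst resolvent_equation[where S = "{0..<int ?L} \<union> {- int p..-1}"]) auto
  also have "(\<Sum>l\<in>{0..<int ?L} \<union> {- int p..-1}. ?w (int i) l * ?P l) =
      (\<Sum>l<?L. ?w (int i) (int l) * ?P (int l)) + (\<Sum>r\<in>{- int p..-1}. ?w (int i) r * ?P r)"
    by (subst sum.union_disjoint)
      (auto simp: sum_int_atLeast0_lessThan simp del: of_nat_Suc sum.lessThan_Suc)
  also have "(\<Sum>r\<in>{- int p..-1}. ?w (int i) r * ?P r) = (\<Sum>l<?L.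
      (\<Sum>r\<in>{- int p..-1}. \<Sum>s\<in>{- int q..-1}.
        fls_const (w_mat p q a (int i) r * w_mat p q a s (int l)) * chi p q a r s) * ?P (int l))"
  proof -
    \<comment> \<open>The range is enlarged to that of row \<open>i\<close> of K; the added entries
      have \<open>s < 0\<close> and \<open>l\<close> at least \<open>q\<close>, outside the
      band.\<close>
    have ext: "(\<Sum>l<q. ?w s (int l) * ?P (int l)) = (\<Sum>l<?L. ?w s (int l) * ?P (int l))"
      if "s < 0" for s
      by (rule sum.mono_neutral_left) (use that in \<open>auto simp: w_mat_def\<close>)
    have "?w (int i) r * ?P r = (\<Sum>l<?L. \<Sum>s\<in>{- int q..-1}.
        fls_const (w_mat p q a (int i) r * w_mat p q a s (int l)) * chi p q a r s * ?P (int l))"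
      if "r < 0" for r
    proof -
      have "?P r = (\<Sum>s\<in>{- int q..-1}. \<Sum>l<?L. chi p q a r s * (?w s (int l) * ?P (int l)))"
        by (subst psi_negative_row[OF that])
          (simp_all add: ext flip: sum_distrib_left del: sum.lessThan_Suc)
      also have "\<dots> = (\<Sum>l<?L. \<Sum>s\<in>{- int q..-1}. chi p q a r s * (?w s (int l) * ?P (int l)))"
        by (rule sum.swap)
      finally show ?thesis
        by (simp add: sum_distrib_left mult_ac flip: fls_const_mult_const del: sum.lessThan_Suc)
    qed
    then show ?thesis
      unfolding sum_distrib_right by (subst (2) sum.swap) (rule sum.cong, auto)
  qed
  finally show ?thesis
    by (simp add: K_mat_eq distrib_right sum.distrib add.assoc del: sum.lessThan_Suc)
qed

section \<open>The inverse of z - K and the comparison of columns\<close>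

lemma zeta_carrier: "zeta p q a \<in> laurent_mat_carrier"
  using monoid.Units_inv_closed[OF ring.is_monoid[OF ring_laurent_mat_ring] zI_minus_K_Units]
  by (simp add: zeta_def laurent_mat_ring_simps)

text \<open>This is the right-inverse identity read entrywise; row \<open>i\<close> of z - K ends at
  column \<open>i + q\<close>, so the product is an ordinary finite sum.\<close>

lemma zeta_K_mat_equation:
  "fls_X_inv * zeta p q a i j =
     (if i = j then 1 else 0) + (\<Sum>l<Suc (i + q). K_mat p q a i l * zeta p q a l j)"
proof -
  interpret Ring.ring laurent_mat_ring by (rule ring_laurent_mat_ring)
  let ?L = "Suc (i + q)"
  have "vanishes_below (zI_minus_K p q a i l) (-1)" for l
    unfolding zI_minus_K_def
    by (intro vanishes_below_diff vanishes_below_mono[OF vanishes_below_K_mat])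
      (auto simp: vanishes_below_def)
  then have "laurent_mat_mult (zI_minus_K p q a) (zeta p q a) i j =
      (\<Sum>l<?L. zI_minus_K p q a i l * zeta p q a l j)"
    by (rule laurent_mat_mult_finite_row[OF _ zeta_carrier]) (simp add: zI_minus_K_def K_mat_eq_0)
  also have "\<dots> = (\<Sum>l<?L. if i = l then fls_X_inv * zeta p q a l j else 0) -
      (\<Sum>l<?L. K_mat p q a i l * zeta p q a l j)"
    unfolding sum_subtractf[symmetric]
    by (intro sum.cong) (auto simp: zI_minus_K_def left_diff_distrib)
  also have "(\<Sum>l<?L. if i = l then fls_X_inv * zeta p q a l j else 0) = fls_X_inv * zeta p q a i j"
    by (subst sum.delta') auto
  finally show ?thesis
    using fun_cong[OF fun_cong[OF Units_r_inv[OF zI_minus_K_Units, of p q a]], of i j]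
    by (simp only: zeta_def[symmetric] laurent_mat_ring_simps diff_eq_eq)
qed

text \<open>For fixed \<open>j\<close> both columns solve the same system with matrix z - K.
  Membership of \<open>zeta\<close> in the carrier supplies the common bound \<open>d\<close>; since
  \<open>d\<close> is at most 0, it also bounds \<open>psi\<close>.\<close>

lemma psi_eq_zeta: "psi p q a (int i) (int j) = zeta p q a i j"
proof -
  obtain d where d: "d \<le> 0" "\<And>i j. vanishes_below (zeta p q a i j) d"
    using laurent_mat_carrier_bound[OF zeta_carrier] by blast
  have "vanishes_below (psi p q a (int i) (int j) - zeta p q a i j) d" for i
    unfolding psi_def using d
    by (intro vanishes_below_diff vanishes_below_mono[OF vanishes_below_moment_series]) auto
  then have "psi p q a (int i) (int j) - zeta p q a i j = 0"
    by (intro fls_X_inv_system_trivial[where I = UNIV and S = "\<lambda>i. {..<Suc (i + q)}"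
          and g = "\<lambda>i. psi p q a (int i) (int j) - zeta p q a i j" and M = "K_mat p q a" and d = d])
      (auto simp: right_diff_distrib psi_K_mat_equation zeta_K_mat_equation sum_subtractf
        vanishes_below_K_mat simp del: sum.lessThan_Suc)
  then show ?thesis by simp
qed

theorem theorem5p1:
  fixes p q :: nat
    and a :: "int \<Rightarrow> int \<Rightarrow> complex"
    and i j :: nat
  assumes "p \<ge> 1" and "q \<ge> 1"
  shows "path_series p q a (int i) (int j) = psi p q a (int i) (int j) \<and>
         psi p q a (int i) (int j) = zeta p q a i j"
  by (simp add: path_series_def psi_def path_count_eq_mat_pow flip: psi_eq_zeta)

end
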